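(* A necessary and sufficient condition for the existence of a rational convex quadrilateral is that there exist rational numbers $a,b,c,d,e,f,x_1,x_2,y_1$ and $y_2$ satisfying the simultaneous diophantine equations \begin{align*} x_1^2+y_1^2&=a^2,\\ (e-x_1)^2+y_1^2&=b^2,\\ (e-x_2)^2+y_2^2&=c^2,\\ x_2^2+y_2^2&=d^2,\\ (x_1-x_2)^2+(y_1-y_2)^2&=f^2, \end{align*} and such that the following rational numbers are all positive: $a,b,c,d,e,f$, $-y_1y_2$, $-(y_1-y_2)(x_1y_2-x_2y_1)$ and $(y_1-y_2)(ey_1-ey_2+x_1y_2-x_2y_1)$.
   Context: A quadrilateral is called rational if its four sides, its two diagonals and its area are all given by rational numbers. *)

theory Defs
  imports "HOL-Analysis.Analysis"
begin

definition quad_path :: "real^2 \<Rightarrow> real^2 \<Rightarrow> real^2 \<Rightarrow> real^2 \<Rightarrow> real \<Rightarrow> real^2" where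
  "quad_path A B C D = linepath A B +++ linepath B C +++ linepath C D +++ linepath D A"

text \<open>
  The vertices are listed in cyclic order, so the sides are \<open>AB\<close>, \<open>BC\<close>, \<open>CD\<close>, \<open>DA\<close> and the
  diagonals are \<open>AC\<close>, \<open>BD\<close>. The collinearity conditions exclude straight angles, i.e. triangles
  with an extra vertex marked on a side.
\<close>
definition quadrilateral :: "real^2 \<Rightarrow> real^2 \<Rightarrow> real^2 \<Rightarrow> real^2 \<Rightarrow> bool" where
  "quadrilateral A B C D \<longleftrightarrow>
     simple_path (quad_path A B C D) \<and>
     \<not> collinear {A, B, C} \<and> \<not> collinear {B, C, D} \<and>
     \<not> collinear {C, D, A} \<and> \<not> collinear {D, A, B}"

definition quad_region :: "real^2 \<Rightarrow> real^2 \<Rightarrow> real^2 \<Rightarrow> real^2 \<Rightarrow> (real^2) set" where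
  "quad_region A B C D =
     path_image (quad_path A B C D) \<union> inside (path_image (quad_path A B C D))"

definition quad_area :: "real^2 \<Rightarrow> real^2 \<Rightarrow> real^2 \<Rightarrow> real^2 \<Rightarrow> real" where
  "quad_area A B C D = measure lebesgue (quad_region A B C D)"

definition convex_quadrilateral :: "real^2 \<Rightarrow> real^2 \<Rightarrow> real^2 \<Rightarrow> real^2 \<Rightarrow> bool" where
  "convex_quadrilateral A B C D \<longleftrightarrow>
     quadrilateral A B C D \<and> convex (quad_region A B C D)"

definition rational_quadrilateral :: "real^2 \<Rightarrow> real^2 \<Rightarrow> real^2 \<Rightarrow> real^2 \<Rightarrow> bool" where
  "rational_quadrilateral A B C D \<longleftrightarrow>
     quadrilateral A B C D \<and>
     dist A B \<in> \<rat> \<and> dist B C \<in> \<rat> \<and> dist C D \<in> \<rat> \<and> dist D A \<in> \<rat> \<and>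
     dist A C \<in> \<rat> \<and> dist B D \<in> \<rat> \<and>
     quad_area A B C D \<in> \<rat>"

text \<open>
  The equations and sign conditions describe the vertices \<open>A = (0, 0)\<close>, \<open>B = (x1, y1)\<close>,
  \<open>C = (e, 0)\<close>, \<open>D = (x2, y2)\<close>; the last three inequalities say that the diagonals \<open>AC\<close> and
  \<open>BD\<close> cross at a point interior to both.
\<close>
definition quad_conditions ::
    "rat \<Rightarrow> rat \<Rightarrow> rat \<Rightarrow> rat \<Rightarrow> rat \<Rightarrow> rat \<Rightarrow> rat \<Rightarrow> rat \<Rightarrow> rat \<Rightarrow> rat \<Rightarrow> bool" where
  "quad_conditions a b c d e f x1 x2 y1 y2 \<longleftrightarrow>
     x1\<^sup>2 + y1\<^sup>2 = a\<^sup>2 \<and>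
     (e - x1)\<^sup>2 + y1\<^sup>2 = b\<^sup>2 \<and>
     (e - x2)\<^sup>2 + y2\<^sup>2 = c\<^sup>2 \<and>
     x2\<^sup>2 + y2\<^sup>2 = d\<^sup>2 \<and>
     (x1 - x2)\<^sup>2 + (y1 - y2)\<^sup>2 = f\<^sup>2 \<and>
     a > 0 \<and> b > 0 \<and> c > 0 \<and> d > 0 \<and> e > 0 \<and> f > 0 \<and>
     - (y1 * y2) > 0 \<and>
     - ((y1 - y2) * (x1 * y2 - x2 * y1)) > 0 \<and>
     (y1 - y2) * (e * y1 - e * y2 + x1 * y2 - x2 * y1) > 0"

end

theory Submission
  imports Defs
begin

text \<open>
  Everything hinges on the four doubled signed areas of the triangles \<open>ABC\<close>, \<open>BCD\<close>, \<open>CDA\<close> and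
  \<open>DAB\<close>. A quadrilateral is convex exactly when all four have the same sign
  (\<open>convex_quadrilateral_iff_convex_position\<close>), and its area is then half the absolute value of the
  sum of the first and the third (\<open>quad_area_convex_position\<close>).

  From signs to geometry: the barycentric relation among four points of the plane makes the diagonals
  cross in a point of both open segments. Cutting the convex hull of the vertices along \<open>AC\<close> shows
  that its frontier lies in the four sides together with \<open>AC\<close>; cutting along \<open>BD\<close> gives the
  same with \<open>BD\<close>. The two diagonals share only the crossing point, which is an interior point, and
  each side lies on a supporting line of the hull. Hence the quadrilateral is the frontier of the
  hull, and its region is the hull, a union of two triangles that overlap in a null set.

  From geometry to signs: by the Jordan-Brouwer theorem the closed path is the frontier of its region,
  so if the region is convex no vertex can lie in the interior of the triangle of the other three.
  Opposite sides do not meet. The barycentric relation shows that any disagreement of two consecutive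
  signs would violate one of these two facts, or the equality of the two ways to compute the area.

  With \<open>A\<close> as origin and \<open>AC\<close> as first axis, the coordinates of \<open>B\<close> and \<open>D\<close> solve the five equations,
  and the three sign conditions express the agreement of the four signed areas. The first
  coordinates are rational by the law of cosines. The squares \<open>y1\<^sup>2\<close> and \<open>y2\<^sup>2\<close> are then
  rational, and so is \<open>y1 - y2\<close>, which is up to sign twice the area divided by \<open>AC\<close>. As it is nonzero,
  dividing \<open>y1\<^sup>2 - y2\<^sup>2\<close> by it gives \<open>y1 + y2\<close>, so \<open>y1\<close> and \<open>y2\<close> are rational themselves.
  Conversely a solution of the system gives the vertices by their coordinates.
\<close>

section \<open>Signed areas of triangles in the plane\<close>

text \<open>
  Twice the signed area of the triangle \<open>PQR\<close>, positive when it is traversed counterclockwise. As a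
  function of \<open>R\<close> it tells on which side of the line \<open>PQ\<close> the point lies.
\<close>

definition orient :: "real^2 \<Rightarrow> real^2 \<Rightarrow> real^2 \<Rightarrow> real" where
  "orient P Q R = (Q$1 - P$1) * (R$2 - P$2) - (Q$2 - P$2) * (R$1 - P$1)"

lemma orient_rotate: "orient Q R P = orient P Q R"
  by (simp add: orient_def algebra_simps)

lemma orient_swap: "orient Q P R = - orient P Q R"
  by (simp add: orient_def algebra_simps)

lemma orient_degenerate [simp]: "orient P Q P = 0" "orient P Q Q = 0"
  by (simp_all add: orient_def)

lemma orient_convex_combination:
  "orient P Q ((1 - u) *\<^sub>R X + u *\<^sub>R Y) = (1 - u) * orient P Q X + u * orient P Q Y"
  by (simp add: orient_def algebra_simps)

text \<open>
  Both sides are twice the signed area of \<open>ABCD\<close>, cut along one diagonal or the other.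
\<close>

lemma orient_sum: "orient A B C + orient C D A = orient B C D + orient D A B"
  by (simp add: orient_def algebra_simps)

text \<open>
  By \<open>orient_sum\<close> the coefficients have the same sum on both sides. So their signs alone
  decide whether two segments cross or one of the points lies inside the triangle of the others.
\<close>

lemma orient_barycentric:
  "orient B C D *\<^sub>R A + orient D A B *\<^sub>R C = orient C D A *\<^sub>R B + orient A B C *\<^sub>R D"
  by (simp add: vec_eq_iff forall_2 orient_def algebra_simps)

text \<open>
  Writing the sign as an inner product makes the facts about half-spaces and hyperplanes available.
\<close>

lemma orient_eq_inner:
  "orient P Q X = vector [P$2 - Q$2, Q$1 - P$1] \<bullet> X - vector [P$2 - Q$2, Q$1 - P$1] \<bullet> P"
  by (simp add: orient_def inner_vec_def sum_2 algebra_simps)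

lemma normal_vector_nonzero:
  fixes P Q :: "real^2"
  assumes "P \<noteq> Q"
  shows "(vector [P$2 - Q$2, Q$1 - P$1] :: real^2) \<noteq> 0"
  using assms by (auto simp: vec_eq_iff forall_2)

lemma collinear_iff_orient: "collinear {A, B, C} \<longleftrightarrow> orient A B C = 0"
proof
  assume "collinear {A, B, C}"
  then show "orient A B C = 0"
    unfolding collinear_3_expand
  proof
    assume "\<exists>u. B = u *\<^sub>R A + (1 - u) *\<^sub>R C"
    then obtain u where B: "B = u *\<^sub>R A + (1 - u) *\<^sub>R C" ..
    show "orient A B C = 0"
      by (simp add: B orient_def algebra_simps)
  qed simp
next
  assume 0: "orient A B C = 0"
  show "collinear {A, B, C}"
  proof (cases "A = C")
    case False
    then consider "A$1 \<noteq> C$1" | "A$2 \<noteq> C$2"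
      by (auto simp: vec_eq_iff forall_2)
    then obtain u where "B = u *\<^sub>R A + (1 - u) *\<^sub>R C"
    proof cases
      case 1
      then have "B = ((B$1 - C$1) / (A$1 - C$1)) *\<^sub>R A + (1 - (B$1 - C$1) / (A$1 - C$1)) *\<^sub>R C"
        using 0 by (simp add: vec_eq_iff forall_2 orient_def divide_simps) (simp add: algebra_simps)
      then show thesis by (rule that)
    next
      case 2
      then have "B = ((B$2 - C$2) / (A$2 - C$2)) *\<^sub>R A + (1 - (B$2 - C$2) / (A$2 - C$2)) *\<^sub>R C"
        using 0 by (simp add: vec_eq_iff forall_2 orient_def divide_simps) (simp add: algebra_simps)
      then show thesis by (rule that)
    qed
    then show ?thesis
      by (auto simp: collinear_3_expand)
  qed (simp add: insert_absorb)
qed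

lemma positive_combination_in_interior:
  assumes "\<not> collinear {P, Q, R}" "p > 0" "q > 0" "r > 0"
    and "(p + q + r) *\<^sub>R Y = p *\<^sub>R P + q *\<^sub>R Q + r *\<^sub>R R"
  shows "Y \<in> interior (convex hull {P, Q, R :: real^2})"
proof -
  define s where "s = p + q + r"
  have s: "s > 0"
    using assms by (simp add: s_def)
  have "Y = (1 / s) *\<^sub>R (s *\<^sub>R Y)"
    using s by simp
  also have "\<dots> = (p / s) *\<^sub>R P + (q / s) *\<^sub>R Q + (r / s) *\<^sub>R R"
    using assms(5) by (simp add: s_def scaleR_right_distrib)
  finally have "(p / s) *\<^sub>R P + (q / s) *\<^sub>R Q + (r / s) *\<^sub>R R = Y" ..
  moreover have "p / s + q / s + r / s = 1"
    using s by (simp add: s_def flip: add_divide_distrib)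
  moreover have "p / s > 0" "q / s > 0" "r / s > 0"
    using assms(2-4) s by simp_all
  ultimately show ?thesis
    unfolding interior_convex_hull_3_minimal[OF assms(1), simplified] by blast
qed

section \<open>Vertices in convex position\<close>

definition convex_position :: "real^2 \<Rightarrow> real^2 \<Rightarrow> real^2 \<Rightarrow> real^2 \<Rightarrow> bool" where
  "convex_position A B C D \<longleftrightarrow>
     (orient A B C > 0 \<and> orient B C D > 0 \<and> orient C D A > 0 \<and> orient D A B > 0) \<or>
     (orient A B C < 0 \<and> orient B C D < 0 \<and> orient C D A < 0 \<and> orient D A B < 0)"

lemma convex_position_rotate: "convex_position A B C D \<Longrightarrow> convex_position B C D A"
  by (auto simp: convex_position_def)

lemma convex_position_distinct:
  assumes "convex_position A B C D"
  shows "distinct [A, B, C, D]"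
  using assms by (auto simp: convex_position_def orient_def)

text \<open>
  When all four coefficients of \<open>orient_barycentric\<close> have the same sign, dividing by their
  common sum turns each side into a proper convex combination of the ends of a diagonal.
\<close>

lemma convex_position_diagonals_cross:
  assumes "convex_position A B C D"
  obtains X where "X \<in> open_segment A C" "X \<in> open_segment B D"
proof
  define s where "s = orient A B C + orient C D A"
  define X where "X = (1 - orient D A B / s) *\<^sub>R A + (orient D A B / s) *\<^sub>R C"
  have s: "s = orient B C D + orient D A B"
    unfolding s_def by (rule orient_sum)
  have s0: "s \<noteq> 0"
    using assms by (auto simp: convex_position_def s_def)
  have 1: "0 < orient D A B / s \<and> orient D A B / s < 1"
    using assms unfolding convex_position_def s by (auto simp: divide_simps)
  have 2: "0 < orient A B C / s \<and> orient A B C / s < 1"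
    using assms unfolding convex_position_def s_def by (auto simp: divide_simps)
  have "s *\<^sub>R X = orient B C D *\<^sub>R A + orient D A B *\<^sub>R C"
    using s0 by (simp add: X_def s scaleR_right_distrib right_diff_distrib)
  also have "\<dots> = orient C D A *\<^sub>R B + orient A B C *\<^sub>R D"
    by (rule orient_barycentric)
  also have "\<dots> = s *\<^sub>R ((1 - orient A B C / s) *\<^sub>R B + (orient A B C / s) *\<^sub>R D)"
    using s0 by (simp add: s_def scaleR_right_distrib right_diff_distrib)
  finally have X: "X = (1 - orient A B C / s) *\<^sub>R B + (orient A B C / s) *\<^sub>R D"
    using s0 by simp
  show "X \<in> open_segment A C"
    using convex_position_distinct[OF assms] 1 by (auto simp: in_segment X_def)
  show "X \<in> open_segment B D"
    using convex_position_distinct[OF assms] 2 X by (auto simp: in_segment)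
qed

text \<open>
  The line \<open>AB\<close> supports the hull, because \<open>C\<close> and \<open>D\<close> lie on the same side of it.
\<close>

lemma side_subset_frontier_hull:
  assumes "convex_position A B C D"
  shows "closed_segment A B \<subseteq> frontier (convex hull {A, B, C, D})"
proof
  fix X assume X: "X \<in> closed_segment A B"
  \<comment> \<open>Scaling by the orientation makes \<open>n\<close> point inwards for either sense of traversal.\<close>
  define n :: "real^2" where "n = orient A B C *\<^sub>R vector [A$2 - B$2, B$1 - A$1]"
  have ori: "orient A B C * orient A B Y = n \<bullet> Y - n \<bullet> A" for Y
    by (simp add: n_def orient_eq_inner[of A B Y] right_diff_distrib)
  have n0: "n \<noteq> 0"
    using assms convex_position_distinct[OF assms] normal_vector_nonzero[of A B]
    by (auto simp: n_def convex_position_def)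
  have pos: "orient A B C * orient A B C \<ge> 0" "orient A B C * orient A B D \<ge> 0"
    using assms orient_rotate[of A B D]
    by (auto simp: convex_position_def zero_le_mult_iff)
  have "convex hull {A, B, C, D} \<subseteq> {Y. n \<bullet> Y \<ge> n \<bullet> A}"
  proof (rule hull_minimal)
    have "n \<bullet> B = n \<bullet> A"
      using ori[of B] by simp
    then show "{A, B, C, D} \<subseteq> {Y. n \<bullet> Y \<ge> n \<bullet> A}"
      using pos ori[of C] ori[of D] by auto
  qed (simp add: convex_halfspace_ge)
  from interior_mono[OF this]
  have int: "interior (convex hull {A, B, C, D}) \<subseteq> {Y. n \<bullet> Y > n \<bullet> A}"
    using n0 by simp
  have "orient A B X = 0"
    using X by (auto simp: in_segment orient_convex_combination)
  then have "X \<notin> interior (convex hull {A, B, C, D})"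
    using int ori[of X] by auto
  moreover have "X \<in> convex hull {A, B, C, D}"
    using X hull_mono[of "{A, B}" "{A, B, C, D}" convex] by (auto simp: segment_convex_hull)
  ultimately show "X \<in> frontier (convex hull {A, B, C, D})"
    using closure_subset by (auto simp: frontier_def)
qed

text \<open>
  A point of the hull lies on a segment from a point of \<open>AC\<close> to a point \<open>T\<close> of \<open>BD\<close>. The
  crossing point belongs to both triangles, so the half of \<open>BD\<close> that contains \<open>T\<close> decides in which
  triangle the whole segment stays.
\<close>

lemma hull_eq_Un_triangles:
  assumes "convex_position A B C D"
  shows "convex hull {A, B, C, D} = convex hull {A, B, C} \<union> convex hull {C, D, A}"
proof
  obtain X where X: "X \<in> open_segment A C" "X \<in> open_segment B D"
    using convex_position_diagonals_cross[OF assms] .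
  have XAC: "X \<in> convex hull {A, C}" and XBD: "X \<in> closed_segment B D"
    using X by (auto simp: open_segment_def segment_convex_hull)
  have XT: "X \<in> convex hull {A, B, C}" "X \<in> convex hull {C, D, A}"
    using XAC hull_mono[of "{A, C}" "{A, B, C}" convex] hull_mono[of "{A, C}" "{C, D, A}" convex]
    by auto
  show "convex hull {A, B, C, D} \<subseteq> convex hull {A, B, C} \<union> convex hull {C, D, A}"
  proof
    fix Y assume "Y \<in> convex hull {A, B, C, D}"
    moreover have "{A, B, C, D} \<subseteq> convex hull {A, C} \<union> convex hull {B, D}"
      by (auto intro: hull_inc)
    ultimately have "Y \<in> convex hull (convex hull {A, C} \<union> convex hull {B, D})"
      using hull_mono by blast
    then obtain u v S T where uv: "u \<ge> 0" "v \<ge> 0" "u + v = 1"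
      and S: "S \<in> convex hull {A, C}" and T: "T \<in> convex hull {B, D}"
      and Y: "Y = u *\<^sub>R S + v *\<^sub>R T"
      by (subst (asm) convex_hull_union_two) auto
    have "T \<in> closed_segment B X \<union> closed_segment X D"
      using T Un_closed_segment[OF XBD] by (simp add: segment_convex_hull)
    then show "Y \<in> convex hull {A, B, C} \<union> convex hull {C, D, A}"
    proof
      assume "T \<in> closed_segment B X"
      then have "T \<in> convex hull {A, B, C}"
        using closed_segment_subset[of B "convex hull {A, B, C}" X] XT by (auto intro: hull_inc)
      moreover have "S \<in> convex hull {A, B, C}"
        using S hull_mono[of "{A, C}" "{A, B, C}" convex] by auto
      ultimately show ?thesis
        using uv Y convexD[OF convex_convex_hull] by blast
    next
      assume "T \<in> closed_segment X D"
      then have "T \<in> convex hull {C, D, A}"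
        using closed_segment_subset[of X "convex hull {C, D, A}" D] XT by (auto intro: hull_inc)
      moreover have "S \<in> convex hull {C, D, A}"
        using S hull_mono[of "{A, C}" "{C, D, A}" convex] by auto
      ultimately show ?thesis
        using uv Y convexD[OF convex_convex_hull] by blast
    qed
  qed
  show "convex hull {A, B, C} \<union> convex hull {C, D, A} \<subseteq> convex hull {A, B, C, D}"
    by (intro Un_least hull_mono) auto
qed

text \<open>
  Averaging the representations of the crossing point on the two diagonals gives all four vertices
  positive weights, and such a combination lies in the relative interior.
\<close>

lemma crossing_point_in_interior:
  assumes "convex_position A B C D" "X \<in> open_segment A C" "X \<in> open_segment B D"
  shows "X \<in> interior (convex hull {A, B, C, D})"
proof -
  have dist: "A \<noteq> B" "A \<noteq> C" "A \<noteq> D" "B \<noteq> C" "B \<noteq> D" "C \<noteq> D"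
    using convex_position_distinct[OF assms(1)] by auto
  obtain u where u: "0 < u" "u < 1" "X = (1 - u) *\<^sub>R A + u *\<^sub>R C"
    using assms(2) by (auto simp: in_segment)
  obtain v where v: "0 < v" "v < 1" "X = (1 - v) *\<^sub>R B + v *\<^sub>R D"
    using assms(3) by (auto simp: in_segment)
  define w where "w Y = (if Y = A then 1 - u else if Y = C then u else if Y = B then 1 - v else v) / 2"
    for Y
  have pos: "\<forall>Y\<in>{A, B, C, D}. 0 < w Y"
    using u v by (simp add: w_def)
  have one: "sum w {A, B, C, D} = 1"
    using dist by (simp add: w_def field_simps)
  have "(\<Sum>Y\<in>{A, B, C, D}. w Y *\<^sub>R Y)
      = (1/2) *\<^sub>R ((1 - u) *\<^sub>R A + u *\<^sub>R C) + (1/2) *\<^sub>R ((1 - v) *\<^sub>R B + v *\<^sub>R D)"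
    using dist by (simp add: w_def scaleR_right_distrib add_ac)
  also have "\<dots> = X"
    unfolding u(3)[symmetric] v(3)[symmetric] by (simp flip: scaleR_left_distrib)
  finally have "X \<in> rel_interior (convex hull {A, B, C, D})"
    using explicit_subset_rel_interior_convex_hull_minimal[of "{A, B, C, D}"] pos one by blast
  moreover have "\<not> collinear {A, B, C}"
    using assms(1) by (auto simp: convex_position_def collinear_iff_orient)
  then have "interior (convex hull {A, B, C}) \<noteq> {}"
    using positive_combination_in_interior[of A B C 1 1 1 "(1/3) *\<^sub>R (A + B + C)"]
    by (auto simp: scaleR_right_distrib)
  then have "interior (convex hull {A, B, C, D}) \<noteq> {}"
    using interior_mono[OF hull_mono[of "{A, B, C}" "{A, B, C, D}" convex]] by blast
  ultimately show ?thesis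
    by (simp add: rel_interior_nonempty_interior)
qed

lemma path_image_quad_path:
  "path_image (quad_path A B C D) =
     closed_segment A B \<union> closed_segment B C \<union> closed_segment C D \<union> closed_segment D A"
  by (auto simp: quad_path_def path_image_join)

text \<open>
  Either diagonal cuts the hull into two triangles, so a frontier point off the sides would lie on both
  diagonals. That leaves only their crossing point, which is interior.
\<close>

lemma frontier_hull_convex_position:
  assumes cp: "convex_position A B C D"
  shows "frontier (convex hull {A, B, C, D}) = path_image (quad_path A B C D)"
proof
  note cp2 = convex_position_rotate[OF cp]
  note cp3 = convex_position_rotate[OF cp2]
  note cp4 = convex_position_rotate[OF cp3]
  have perm: "{B, C, D, A} = {A, B, C, D}" "{C, D, A, B} = {A, B, C, D}" "{D, A, B, C} = {A, B, C, D}"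
    by auto
  show "path_image (quad_path A B C D) \<subseteq> frontier (convex hull {A, B, C, D})"
    using side_subset_frontier_hull[OF cp] side_subset_frontier_hull[OF cp2]
      side_subset_frontier_hull[OF cp3] side_subset_frontier_hull[OF cp4]
    by (simp add: path_image_quad_path perm)
  have 1: "frontier (convex hull {A, B, C, D}) \<subseteq> path_image (quad_path A B C D) \<union> closed_segment A C"
    using frontier_Un_subset[of "convex hull {A, B, C}" "convex hull {C, D, A}"]
    by (auto simp: hull_eq_Un_triangles[OF cp] frontier_of_triangle path_image_quad_path
        closed_segment_commute)
  have 2: "frontier (convex hull {A, B, C, D}) \<subseteq> path_image (quad_path A B C D) \<union> closed_segment B D"
    using frontier_Un_subset[of "convex hull {B, C, D}" "convex hull {D, A, B}"]
    by (auto simp: hull_eq_Un_triangles[OF cp2, unfolded perm] frontier_of_triangle path_image_quad_path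
        closed_segment_commute)
  show "frontier (convex hull {A, B, C, D}) \<subseteq> path_image (quad_path A B C D)"
  proof
    fix Y assume Y: "Y \<in> frontier (convex hull {A, B, C, D})"
    show "Y \<in> path_image (quad_path A B C D)"
    proof (rule ccontr)
      assume no: "Y \<notin> path_image (quad_path A B C D)"
      then have "Y \<in> closed_segment A C" "Y \<in> closed_segment B D"
        using 1 2 Y by auto
      moreover have "Y \<notin> {A, B, C, D}"
        using no by (auto simp: path_image_quad_path)
      ultimately have "Y \<in> interior (convex hull {A, B, C, D})"
        by (intro crossing_point_in_interior[OF cp]) (auto simp: open_segment_def)
      with Y show False
        by (simp add: frontier_def)
    qed
  qed
qed

lemma quad_region_convex_position:
  assumes "convex_position A B C D"
  shows "quad_region A B C D = convex hull {A, B, C, D}"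
proof -
  have b: "bounded (convex hull {A, B, C, D})" and c: "closed (convex hull {A, B, C, D})"
    using compact_convex_hull[of "{A, B, C, D}"] compact_imp_bounded compact_imp_closed by auto
  have "inside (path_image (quad_path A B C D)) = interior (convex hull {A, B, C, D})"
    using b by (simp add: inside_frontier_eq_interior flip: frontier_hull_convex_position[OF assms])
  then show ?thesis
    using interior_subset[of "convex hull {A, B, C, D}"] c
    by (auto simp: quad_region_def frontier_def simp flip: frontier_hull_convex_position[OF assms])
qed

text \<open>
  \<open>CD\<close> stays strictly on one side of the line \<open>AB\<close>.
\<close>

lemma opposite_sides_disjoint:
  assumes "convex_position A B C D"
  shows "closed_segment A B \<inter> closed_segment C D = {}"
proof -
  have "orient A B X = 0" if "X \<in> closed_segment A B" for X
    using that by (auto simp: in_segment orient_convex_combination)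
  moreover have "orient A B X \<noteq> 0" if "X \<in> closed_segment C D" for X
  proof -
    obtain u where u: "0 \<le> u" "u \<le> 1" "X = (1 - u) *\<^sub>R C + u *\<^sub>R D"
      using \<open>X \<in> closed_segment C D\<close> by (auto simp: in_segment)
    have "(0 < orient A B C \<and> 0 < orient A B D) \<or> (orient A B C < 0 \<and> orient A B D < 0)"
      using assms orient_rotate[of A B D] by (auto simp: convex_position_def)
    then show ?thesis
    proof
      assume "0 < orient A B C \<and> 0 < orient A B D"
      then have "(1 - u) * orient A B C + u * orient A B D > 0"
        using convex_bound_lt[of "- orient A B C" 0 "- orient A B D" "1 - u" u] u by simp
      then show ?thesis by (simp add: u orient_convex_combination)
    next
      assume "orient A B C < 0 \<and> orient A B D < 0"
      then have "(1 - u) * orient A B C + u * orient A B D < 0"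
        using convex_bound_lt[of "orient A B C" 0 "orient A B D" "1 - u" u] u by simp
      then show ?thesis by (simp add: u orient_convex_combination)
    qed
  qed
  ultimately show ?thesis by blast
qed

lemma simple_path_quad_path_iff:
  "simple_path (quad_path A B C D) \<longleftrightarrow>
     A \<noteq> B \<and> B \<noteq> C \<and> C \<noteq> D \<and> D \<noteq> A \<and>
     closed_segment A B \<inter> (closed_segment B C \<union> closed_segment C D \<union> closed_segment D A) \<subseteq> {A, B} \<and>
     closed_segment B C \<inter> (closed_segment C D \<union> closed_segment D A) \<subseteq> {C} \<and>
     closed_segment C D \<inter> closed_segment D A \<subseteq> {D}"
proof -
  have arc: "arc (linepath P Q) \<longleftrightarrow> P \<noteq> Q" for P Q :: "real^2"
    using arc_distinct_ends by fastforce
  show ?thesis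
    by (auto simp: quad_path_def simple_path_join_loop_eq arc_join_eq arc path_image_join)
qed

lemma quadrilateral_convex_position:
  assumes cp: "convex_position A B C D"
  shows "quadrilateral A B C D"
proof -
  have nc: "\<not> collinear {A, B, C}" "\<not> collinear {B, C, D}" "\<not> collinear {C, D, A}" "\<not> collinear {D, A, B}"
    using cp by (auto simp: convex_position_def collinear_iff_orient)
  have "closed_segment A B \<inter> closed_segment B C = {B}" "closed_segment B C \<inter> closed_segment C D = {C}"
    "closed_segment C D \<inter> closed_segment D A = {D}" "closed_segment D A \<inter> closed_segment A B = {A}"
    using nc by (auto intro!: Int_closed_segment)
  then show ?thesis
    using nc convex_position_distinct[OF cp] opposite_sides_disjoint[OF cp]
      opposite_sides_disjoint[OF convex_position_rotate[OF cp]]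
    unfolding quadrilateral_def simple_path_quad_path_iff by auto
qed

text \<open>
  The diagonal \<open>AC\<close> separates the two triangles that make up the hull, so they meet in a null set.
\<close>

lemma quad_area_convex_position:
  assumes cp: "convex_position A B C D"
  shows "quad_area A B C D = \<bar>orient A B C + orient C D A\<bar> / 2"
proof -
  define n :: "real^2" where "n = vector [A$2 - C$2, C$1 - A$1]"
  have ori: "orient A C Y = n \<bullet> Y - n \<bullet> A" for Y
    unfolding n_def by (rule orient_eq_inner)
  have n0: "n \<noteq> 0"
    using convex_position_distinct[OF cp] normal_vector_nonzero[of A C] by (auto simp: n_def)
  have sgn: "(orient A C B < 0 \<and> orient A C D > 0) \<or> (orient A C B > 0 \<and> orient A C D < 0)"
    using cp orient_rotate[of C D A] orient_swap[of C A B] orient_rotate[of C A B] orient_rotate[of B C A]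
    by (auto simp: convex_position_def)
  have half: "convex hull {A, B, C} \<inter> convex hull {C, D, A} \<subseteq> {Y. n \<bullet> Y = n \<bullet> A}"
  proof -
    have nC: "n \<bullet> C = n \<bullet> A"
      using ori[of C] by simp
    from sgn show ?thesis
    proof
      assume s: "orient A C B < 0 \<and> orient A C D > 0"
      have "convex hull {A, B, C} \<subseteq> {Y. n \<bullet> Y \<le> n \<bullet> A}"
        using s nC ori[of B] by (intro hull_minimal) (auto simp: convex_halfspace_le)
      moreover have "convex hull {C, D, A} \<subseteq> {Y. n \<bullet> Y \<ge> n \<bullet> A}"
        using s nC ori[of D] by (intro hull_minimal) (auto simp: convex_halfspace_ge)
      ultimately show ?thesis by force
    next
      assume s: "orient A C B > 0 \<and> orient A C D < 0"
      have "convex hull {A, B, C} \<subseteq> {Y. n \<bullet> Y \<ge> n \<bullet> A}"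
        using s nC ori[of B] by (intro hull_minimal) (auto simp: convex_halfspace_ge)
      moreover have "convex hull {C, D, A} \<subseteq> {Y. n \<bullet> Y \<le> n \<bullet> A}"
        using s nC ori[of D] by (intro hull_minimal) (auto simp: convex_halfspace_le)
      ultimately show ?thesis by force
    qed
  qed
  have neg: "negligible (convex hull {A, B, C} \<inter> convex hull {C, D, A})"
    using negligible_subset[OF negligible_hyperplane half] n0 by blast
  have meas: "convex hull {P, Q, R} \<in> lmeasurable" for P Q R :: "real^2"
    by (intro measurable_convex compact_imp_bounded compact_convex_hull) auto
  have tri: "measure lebesgue (convex hull {P, Q, R}) = \<bar>orient P Q R\<bar> / 2" for P Q R
  proof -
    have "convex hull {P, Q, R} \<in> sets lborel"
      by (simp add: borel_compact compact_convex_hull)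
    then have "measure lebesgue (convex hull {P, Q, R}) = measure lborel (convex hull {P, Q, R})"
      by (rule measure_completion)
    then show ?thesis
      by (simp add: content_triangle orient_def abs_minus_commute algebra_simps)
  qed
  have "quad_area A B C D = measure lebesgue (convex hull {A, B, C} \<union> convex hull {C, D, A})"
    by (simp add: quad_area_def quad_region_convex_position[OF cp] hull_eq_Un_triangles[OF cp])
  also have "\<dots> = \<bar>orient A B C\<bar> / 2 + \<bar>orient C D A\<bar> / 2"
    using meas negligible_imp_measure0[OF neg] by (simp add: measure_Un3 tri)
  also have "\<dots> = \<bar>orient A B C + orient C D A\<bar> / 2"
    using cp by (auto simp: convex_position_def)
  finally show ?thesis .
qed

section \<open>Convex quadrilaterals have their vertices in convex position\<close>

text \<open>
  The region is the complement of the outer component of the complement of the path, and by the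
  Jordan-Brouwer theorem the path is the frontier of each such component.
\<close>

lemma frontier_quad_region:
  assumes "simple_path (quad_path A B C D)"
  shows "frontier (quad_region A B C D) = path_image (quad_path A B C D)"
proof -
  let ?P = "path_image (quad_path A B C D)"
  have "?P homeomorphic sphere (0::complex) 1"
    using assms by (intro homeomorphic_simple_path_image_circle) (auto simp: quad_path_def)
  also have "sphere (0::complex) 1 homeomorphic sphere (0::real^2) 1"
    by (rule homeomorphic_spheres') auto
  finally have hom: "?P homeomorphic sphere (0::real^2) 1" .
  have "bounded ?P"
    using assms by (simp add: bounded_simple_path_image)
  then have "outside ?P \<in> components (- ?P)"
    by (simp add: outside_in_components connected_outside outside_bounded_nonempty)
  then have "frontier (outside ?P) = ?P"
    by (intro Jordan_Brouwer_frontier[OF hom]) auto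
  then show ?thesis
    by (simp add: quad_region_def union_with_inside frontier_complement)
qed

lemma equal_combinations_in_segments:
  fixes P Q R S :: "'a::real_vector"
  assumes "p > 0" "q > 0" "r > 0" "s > 0" "p + q = r + s"
    and "p *\<^sub>R P + q *\<^sub>R Q = r *\<^sub>R R + s *\<^sub>R S"
  shows "closed_segment P Q \<inter> closed_segment R S \<noteq> {}"
proof -
  define t where "t = p + q"
  define Y where "Y = (1 / t) *\<^sub>R (p *\<^sub>R P + q *\<^sub>R Q)"
  have t: "t > 0" "t = r + s"
    using assms by (auto simp: t_def)
  have "1 - q / t = p / t" "1 - s / t = r / t"
    using t by (auto simp: field_simps t_def)
  then have "Y = (1 - q / t) *\<^sub>R P + (q / t) *\<^sub>R Q"
    by (simp add: Y_def scaleR_right_distrib)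
  moreover have "Y = (1 - s / t) *\<^sub>R R + (s / t) *\<^sub>R S"
    unfolding Y_def assms(6) \<open>1 - s / t = r / t\<close> by (simp add: scaleR_right_distrib)
  moreover have "0 \<le> q / t" "q / t \<le> 1" "0 \<le> s / t" "s / t \<le> 1"
    using assms t by (auto simp: divide_simps t_def)
  ultimately have "Y \<in> closed_segment P Q" "Y \<in> closed_segment R S"
    unfolding in_segment by blast+
  then show ?thesis by blast
qed

text \<open>
  The heart of the converse. The hypotheses on \<open>o1\<close>, ..., \<open>o4\<close> are those satisfied by
  \<open>orient A B C\<close>, \<open>orient B C D\<close>, \<open>orient C D A\<close> and \<open>orient D A B\<close>, and also by their
  negatives. Stating the lemma for arbitrary coefficients thus lets it serve for both orientations.
  Moving the terms of the relation to the sides where their coefficients become positive shows a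
  vertex inside the triangle of the others, or a common point of \<open>BC\<close> and \<open>DA\<close>; strictly
  alternating signs contradict \<open>o1 + o3 = o2 + o4\<close>.
\<close>

lemma consecutive_signs_not_opposite:
  fixes A B C D :: "real^2"
  assumes nc: "\<not> collinear {B, D, A}" "\<not> collinear {D, A, C}"
    and "C \<notin> interior (convex hull {B, D, A})" "B \<notin> interior (convex hull {D, A, C})"
    and "closed_segment B C \<inter> closed_segment D A = {}"
    and "o3 \<noteq> 0" "o4 \<noteq> 0" "o1 + o3 = o2 + o4"
    and bary: "o2 *\<^sub>R A + o4 *\<^sub>R C = o3 *\<^sub>R B + o1 *\<^sub>R D"
  shows "\<not> (o1 > 0 \<and> o2 < 0)"
proof
  assume s: "o1 > 0 \<and> o2 < 0"
  consider "o3 > 0" "o4 > 0" | "o3 > 0" "o4 < 0" | "o3 < 0" "o4 > 0" | "o3 < 0" "o4 < 0"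
    using assms by linarith
  then show False
  proof cases
    case 1
    have "o3 + o1 + - o2 = o4"
      using assms(8) by simp
    moreover have "o4 *\<^sub>R C = o3 *\<^sub>R B + o1 *\<^sub>R D + (- o2) *\<^sub>R A"
      unfolding bary[symmetric] by simp
    ultimately have comb: "(o3 + o1 + - o2) *\<^sub>R C = o3 *\<^sub>R B + o1 *\<^sub>R D + (- o2) *\<^sub>R A"
      by (simp only:)
    show False
      using positive_combination_in_interior[OF nc(1) _ _ _ comb] s 1 assms(3) by simp
  next
    case 2
    then show False using s assms by linarith
  next
    case 3
    have "(- o3) *\<^sub>R B + o4 *\<^sub>R C = o1 *\<^sub>R D + (- o2) *\<^sub>R A"
      using bary by (simp add: algebra_simps)
    then show False
      using equal_combinations_in_segments[of "- o3" o4 o1 "- o2" B C D A] s 3 assms by auto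
  next
    case 4
    have "o1 + - o2 + - o4 = - o3"
      using assms(8) by simp
    moreover have "(- o3) *\<^sub>R B = o1 *\<^sub>R D + (- o2) *\<^sub>R A + (- o4) *\<^sub>R C"
      using bary by (simp add: algebra_simps)
    ultimately have comb: "(o1 + - o2 + - o4) *\<^sub>R B = o1 *\<^sub>R D + (- o2) *\<^sub>R A + (- o4) *\<^sub>R C"
      by (simp only:)
    show False
      using positive_combination_in_interior[OF nc(2) _ _ _ comb] s 4 assms(4) by simp
  qed
qed

text \<open>
  An interior point of a triangle with vertices in a convex set is interior to that set, hence no
  frontier point. This supplies the vertex conditions of \<open>consecutive_signs_not_opposite\<close>.
\<close>

lemma boundary_vertices_consecutive_signs:
  assumes K: "convex K" and K': "A \<in> frontier K" "B \<in> frontier K" "C \<in> frontier K" "D \<in> frontier K"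
    and KC: "closed K"
    and nc: "orient A B C \<noteq> 0" "orient B C D \<noteq> 0" "orient C D A \<noteq> 0" "orient D A B \<noteq> 0"
    and disj: "closed_segment B C \<inter> closed_segment D A = {}"
  shows "orient A B C * orient B C D > 0"
proof -
  have inK: "P \<in> K" "P \<notin> interior K" if "P \<in> frontier K" for P
    using that KC by (auto simp: frontier_def)
  have "interior (convex hull {P, Q, R}) \<subseteq> interior K"
    if "P \<in> frontier K" "Q \<in> frontier K" "R \<in> frontier K" for P Q R
    using that inK K by (intro interior_mono hull_minimal) auto
  then have int: "C \<notin> interior (convex hull {B, D, A})" "B \<notin> interior (convex hull {D, A, C})"
    using K' inK by blast+
  have col: "\<not> collinear {B, D, A}" "\<not> collinear {D, A, C}"
    using nc orient_rotate[of A B D] orient_rotate[of B D A] orient_rotate[of D A C]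
    by (auto simp: collinear_iff_orient)
  have 1: "\<not> (orient A B C > 0 \<and> orient B C D < 0)"
    using consecutive_signs_not_opposite[OF col int disj nc(3,4) orient_sum orient_barycentric] .
  have 2: "\<not> (- orient A B C > 0 \<and> - orient B C D < 0)"
    by (rule consecutive_signs_not_opposite[OF col int disj, where ?o3.0 = "- orient C D A" and ?o4.0 = "- orient D A B"])
      (use nc orient_sum[of A B C D] orient_barycentric[of B C D A] in \<open>simp_all add: algebra_simps\<close>)
  from 1 2 show ?thesis
    using nc(1,2) by (auto simp: zero_less_mult_iff)
qed

text \<open>
  Applying \<open>boundary_vertices_consecutive_signs\<close> to the cyclic shifts of the vertices makes each of
  three consecutive pairs of signs agree, which links all four.
\<close>

lemma convex_position_convex_quadrilateral:
  assumes "convex_quadrilateral A B C D"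
  shows "convex_position A B C D"
proof -
  let ?K = "quad_region A B C D"
  have quad: "quadrilateral A B C D" and K: "convex ?K"
    using assms by (auto simp: convex_quadrilateral_def)
  have sp: "simple_path (quad_path A B C D)"
    and nc: "orient A B C \<noteq> 0" "orient B C D \<noteq> 0" "orient C D A \<noteq> 0" "orient D A B \<noteq> 0"
    using quad by (auto simp: quadrilateral_def collinear_iff_orient)
  have fr: "frontier ?K = path_image (quad_path A B C D)"
    using sp by (rule frontier_quad_region)
  then have "frontier ?K \<subseteq> ?K"
    by (simp add: quad_region_def)
  then have cl: "closed ?K"
    by (simp add: frontier_subset_eq)
  have v: "A \<in> frontier ?K" "B \<in> frontier ?K" "C \<in> frontier ?K" "D \<in> frontier ?K"
    by (auto simp: fr path_image_quad_path)
  \<comment> \<open>A simple path allows opposite sides to share only a vertex, which noncollinearity excludes.\<close>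
  have notin: "R \<notin> closed_segment P Q" if "orient P Q R \<noteq> 0" for P Q R
    using that by (auto simp: in_segment orient_convex_combination)
  have d1: "closed_segment A B \<inter> closed_segment C D = {}"
    using sp notin[of C D A] notin[of C D B] nc orient_rotate[of C D B]
    by (auto simp: simple_path_quad_path_iff)
  have d2: "closed_segment B C \<inter> closed_segment D A = {}"
    using sp notin[of D A C] nc orient_rotate[of D A C]
    by (auto simp: simple_path_quad_path_iff)
  have "orient A B C * orient B C D > 0"
    using boundary_vertices_consecutive_signs[OF K v cl nc d2] .
  moreover have "orient B C D * orient C D A > 0"
    using boundary_vertices_consecutive_signs[OF K v(2-4,1) cl nc(2-4,1)] d1 by blast
  moreover have "orient C D A * orient D A B > 0"
    using boundary_vertices_consecutive_signs[OF K v(3,4,1,2) cl nc(3,4,1,2)] d2 by blast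
  ultimately show ?thesis
    by (auto simp: convex_position_def zero_less_mult_iff)
qed

theorem convex_quadrilateral_iff_convex_position:
  "convex_quadrilateral A B C D \<longleftrightarrow> convex_position A B C D"
proof
  assume "convex_position A B C D"
  then show "convex_quadrilateral A B C D"
    by (simp add: convex_quadrilateral_def quadrilateral_convex_position
        quad_region_convex_position convex_convex_hull)
qed (rule convex_position_convex_quadrilateral)

section \<open>Coordinates along a diagonal\<close>

lemma dist_vec2_square: "(dist P Q)\<^sup>2 = (P$1 - Q$1)\<^sup>2 + (P$2 - Q$2)\<^sup>2" for P Q :: "real^2"
  by (simp add: dist_vec_def L2_set_def sum_2 dist_real_def)

text \<open>
  Signed coordinates of \<open>P\<close> in the orthonormal frame with origin \<open>A\<close> and first axis pointing to \<open>C\<close>.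
\<close>

definition along :: "real^2 \<Rightarrow> real^2 \<Rightarrow> real^2 \<Rightarrow> real" where
  "along A C P = ((P - A) \<bullet> (C - A)) / dist A C"

definition across :: "real^2 \<Rightarrow> real^2 \<Rightarrow> real^2 \<Rightarrow> real" where
  "across A C P = orient A C P / dist A C"

lemma along_across_endpoints [simp]:
  "along A C A = 0" "across A C A = 0" "along A C C = dist A C" "across A C C = 0"
  by (simp_all add: along_def across_def dist_norm norm_minus_commute dot_square_norm power2_eq_square)

text \<open>
  This is Lagrange's identity: the squared inner product and the squared cross product of two
  vectors add up to the product of their squared lengths.
\<close>

lemma along_across_isometry:
  assumes "A \<noteq> C"
  shows "(along A C P - along A C Q)\<^sup>2 + (across A C P - across A C Q)\<^sup>2 = (dist P Q)\<^sup>2"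
proof -
  have "(along A C P - along A C Q)\<^sup>2 + (across A C P - across A C Q)\<^sup>2
      = (((P - A) \<bullet> (C - A) - (Q - A) \<bullet> (C - A))\<^sup>2 + (orient A C P - orient A C Q)\<^sup>2) / (dist A C)\<^sup>2"
    by (simp add: along_def across_def power_divide add_divide_distrib flip: diff_divide_distrib)
  also have "((P - A) \<bullet> (C - A) - (Q - A) \<bullet> (C - A))\<^sup>2 + (orient A C P - orient A C Q)\<^sup>2
      = (dist P Q)\<^sup>2 * (dist A C)\<^sup>2"
    unfolding dist_vec2_square orient_def by (simp add: inner_vec_def sum_2) algebra
  finally show ?thesis
    using assms by simp
qed

lemma along_across_orient:
  assumes "A \<noteq> C"
  shows "along A C P * across A C Q - along A C Q * across A C P = orient A P Q"
proof -
  have "along A C P * across A C Q - along A C Q * across A C P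
      = ((P - A) \<bullet> (C - A) * orient A C Q - (Q - A) \<bullet> (C - A) * orient A C P) / (dist A C)\<^sup>2"
    by (simp add: along_def across_def power2_eq_square diff_divide_distrib)
  also have "(P - A) \<bullet> (C - A) * orient A C Q - (Q - A) \<bullet> (C - A) * orient A C P
      = orient A P Q * (dist A C)\<^sup>2"
    unfolding dist_vec2_square orient_def by (simp add: inner_vec_def sum_2) algebra
  finally show ?thesis
    using assms by simp
qed

text \<open>
  The law of cosines in the triangle \<open>APC\<close>, solved for the projection of \<open>AP\<close> onto \<open>AC\<close>.
\<close>

lemma along_rational:
  assumes "A \<noteq> C" "dist A C \<in> \<rat>" "dist A P \<in> \<rat>" "dist P C \<in> \<rat>"
  shows "along A C P \<in> \<rat>"
proof -
  have "2 * dist A C * along A C P = (dist A C)\<^sup>2 + (dist A P)\<^sup>2 - (dist P C)\<^sup>2"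
    using along_across_isometry[OF assms(1), of A P] along_across_isometry[OF assms(1), of P C]
    by (simp add: power2_diff algebra_simps)
  then have "along A C P = ((dist A C)\<^sup>2 + (dist A P)\<^sup>2 - (dist P C)\<^sup>2) / (2 * dist A C)"
    using assms(1) by (simp add: field_simps)
  then show ?thesis
    using assms(2-4) by simp
qed

text \<open>
  Dividing the difference of the squares by \<open>x - y\<close> makes \<open>x + y\<close> rational as well.
\<close>

lemma Rats_if_squares_and_difference:
  fixes x y :: real
  assumes "x\<^sup>2 \<in> \<rat>" "y\<^sup>2 \<in> \<rat>" "x - y \<in> \<rat>" "x \<noteq> y"
  shows "x \<in> \<rat>" "y \<in> \<rat>"
proof -
  have "x = ((x\<^sup>2 - y\<^sup>2) / (x - y) + (x - y)) / 2"
    using assms(4) by (simp add: power2_eq_square field_simps)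
  also have "\<dots> \<in> \<rat>"
    using assms by simp
  finally show "x \<in> \<rat>" .
  then have "x - (x - y) \<in> \<rat>"
    using assms(3) by (rule Rats_diff)
  then show "y \<in> \<rat>"
    by simp
qed

section \<open>Translation into diophantine equations\<close>

lemma quad_conditions_real_iff:
  fixes a b c d e f x1 x2 y1 y2 :: rat
  defines "r \<equiv> (of_rat :: rat \<Rightarrow> real)"
  shows "quad_conditions a b c d e f x1 x2 y1 y2 \<longleftrightarrow>
     (r x1)\<^sup>2 + (r y1)\<^sup>2 = (r a)\<^sup>2 \<and>
     (r e - r x1)\<^sup>2 + (r y1)\<^sup>2 = (r b)\<^sup>2 \<and>
     (r e - r x2)\<^sup>2 + (r y2)\<^sup>2 = (r c)\<^sup>2 \<and>
     (r x2)\<^sup>2 + (r y2)\<^sup>2 = (r d)\<^sup>2 \<and>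
     (r x1 - r x2)\<^sup>2 + (r y1 - r y2)\<^sup>2 = (r f)\<^sup>2 \<and>
     r a > 0 \<and> r b > 0 \<and> r c > 0 \<and> r d > 0 \<and> r e > 0 \<and> r f > 0 \<and>
     - (r y1 * r y2) > 0 \<and>
     - ((r y1 - r y2) * (r x1 * r y2 - r x2 * r y1)) > 0 \<and>
     (r y1 - r y2) * (r e * r y1 - r e * r y2 + r x1 * r y2 - r x2 * r y1) > 0"
  unfolding quad_conditions_def r_def
  by (simp only: of_rat_eq_iff zero_less_of_rat_iff
      flip: of_rat_add of_rat_mult of_rat_diff of_rat_power of_rat_minus)

text \<open>
  The unknowns are the coordinates of \<open>B\<close> and \<open>D\<close> along the diagonal \<open>AC\<close>. The rationality of the
  area enters only through the difference \<open>y1 - y2\<close>.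
\<close>

lemma quad_conditions_of_rational_quadrilateral:
  assumes cq: "convex_quadrilateral A B C D" and rq: "rational_quadrilateral A B C D"
    and "dist A B = of_rat a" "dist B C = of_rat b" "dist C D = of_rat c" "dist D A = of_rat d"
      "dist A C = of_rat e" "dist B D = of_rat f"
  shows "\<exists>x1 x2 y1 y2. quad_conditions a b c d e f x1 x2 y1 y2"
proof -
  have cp: "convex_position A B C D"
    using cq by (simp add: convex_quadrilateral_iff_convex_position)
  have ne: "A \<noteq> B" "A \<noteq> C" "A \<noteq> D" "B \<noteq> C" "B \<noteq> D" "C \<noteq> D"
    using convex_position_distinct[OF cp] by auto
  let ?x = "along A C" and ?y = "across A C" and ?e = "dist A C"
  have rat: "dist A B \<in> \<rat>" "dist B C \<in> \<rat>" "dist C D \<in> \<rat>" "dist D A \<in> \<rat>" "?e \<in> \<rat>"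
    and area: "quad_area A B C D \<in> \<rat>"
    using rq by (auto simp: rational_quadrilateral_def)
  have e: "?e > 0"
    using ne by simp
  note iso = along_across_isometry[OF ne(2)]
  have eqs: "(?x B)\<^sup>2 + (?y B)\<^sup>2 = (dist A B)\<^sup>2" "(?e - ?x B)\<^sup>2 + (?y B)\<^sup>2 = (dist B C)\<^sup>2"
    "(?e - ?x D)\<^sup>2 + (?y D)\<^sup>2 = (dist C D)\<^sup>2" "(?x D)\<^sup>2 + (?y D)\<^sup>2 = (dist D A)\<^sup>2"
    "(?x B - ?x D)\<^sup>2 + (?y B - ?y D)\<^sup>2 = (dist B D)\<^sup>2"
    using iso[of A B] iso[of C B] iso[of C D] iso[of D A] iso[of B D]
    by (simp_all add: dist_commute)
  have xr: "?x B \<in> \<rat>" "?x D \<in> \<rat>"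
    using rat ne by (auto intro!: along_rational simp: dist_commute)
  have yB: "?e * ?y B = - orient A B C" and yD: "?e * ?y D = orient C D A"
    using e by (simp_all add: across_def) (simp_all add: orient_def algebra_simps)
  have cross: "?x B * ?y D - ?x D * ?y B = orient D A B"
    using along_across_orient[OF ne(2), of B D] by (simp add: orient_rotate[of A B D])
  have diff: "?e * (?y B - ?y D) = - (orient A B C + orient C D A)"
    by (simp add: right_diff_distrib yB yD)
  have y_ne: "?y B \<noteq> ?y D"
    using diff cp by (auto simp: convex_position_def)
  have "?e * \<bar>?y B - ?y D\<bar> = \<bar>orient A B C + orient C D A\<bar>"
    using arg_cong[OF diff, of abs] e by (simp only: abs_mult abs_minus_cancel abs_of_pos)
  then have "\<bar>?y B - ?y D\<bar> = 2 * quad_area A B C D / ?e"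
    using e by (simp add: quad_area_convex_position[OF cp] field_simps)
  then have "\<bar>?y B - ?y D\<bar> \<in> \<rat>"
    using area rat by simp
  then have y_diff: "?y B - ?y D \<in> \<rat>"
    by (simp add: Rats_abs_iff)
  have "(?y B)\<^sup>2 = (dist A B)\<^sup>2 - (?x B)\<^sup>2" "(?y D)\<^sup>2 = (dist D A)\<^sup>2 - (?x D)\<^sup>2"
    using eqs by linarith+
  then have "(?y B)\<^sup>2 \<in> \<rat>" "(?y D)\<^sup>2 \<in> \<rat>"
    using rat xr by simp_all
  then have yr: "?y B \<in> \<rat>" "?y D \<in> \<rat>"
    using y_diff y_ne Rats_if_squares_and_difference by blast+
  obtain x1 x2 y1 y2 where
    q: "?x B = of_rat x1" "?x D = of_rat x2" "?y B = of_rat y1" "?y D = of_rat y2"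
    using xr yr by (auto elim!: Rats_cases)
  \<comment> \<open>Up to positive factors, the three sign conditions compare signs of the four oriented areas.\<close>
  have "?e * ?e * - (?y B * ?y D) = orient A B C * orient C D A"
    using yB yD by algebra
  moreover have "?e * - ((?y B - ?y D) * (?x B * ?y D - ?x D * ?y B))
      = (orient A B C + orient C D A) * orient D A B"
    unfolding cross using diff by algebra
  moreover have "?e * ?y B - ?e * ?y D + ?x B * ?y D - ?x D * ?y B = - orient B C D"
    using cross yB yD orient_sum[of A B C D] by linarith
  then have "?e * ((?y B - ?y D) * (?e * ?y B - ?e * ?y D + ?x B * ?y D - ?x D * ?y B))
      = (orient A B C + orient C D A) * orient B C D"
    using diff by algebra
  ultimately have
    "?e * ?e * - (?y B * ?y D) > 0"
    "?e * - ((?y B - ?y D) * (?x B * ?y D - ?x D * ?y B)) > 0"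
    "?e * ((?y B - ?y D) * (?e * ?y B - ?e * ?y D + ?x B * ?y D - ?x D * ?y B)) > 0"
    using cp by (auto simp: convex_position_def zero_less_mult_iff)
  then have signs: "- (?y B * ?y D) > 0"
    "- ((?y B - ?y D) * (?x B * ?y D - ?x D * ?y B)) > 0"
    "(?y B - ?y D) * (?e * ?y B - ?e * ?y D + ?x B * ?y D - ?x D * ?y B) > 0"
    using zero_less_mult_pos[OF _ e] zero_less_mult_pos[OF _ mult_pos_pos[OF e e]] by blast+
  have "dist A B > 0" "dist B C > 0" "dist C D > 0" "dist D A > 0" "dist B D > 0"
    using ne by auto
  then have "quad_conditions a b c d e f x1 x2 y1 y2"
    unfolding quad_conditions_real_iff using eqs signs e by (simp only: assms q)
  then show ?thesis by blast
qed

text \<open>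
  The first sign condition puts \<open>B\<close> and \<open>D\<close> on opposite sides of \<open>AC\<close>, so that \<open>y1 - y2\<close>
  has the sign of \<open>y1\<close>; the other two then determine the signs of \<open>DAB\<close> and \<open>BCD\<close>.
\<close>

lemma rational_quadrilateral_of_quad_conditions:
  assumes q: "quad_conditions a b c d e f x1 x2 y1 y2"
  shows "\<exists>A B C D. convex_quadrilateral A B C D \<and> rational_quadrilateral A B C D \<and>
           dist A B = of_rat a \<and> dist B C = of_rat b \<and> dist C D = of_rat c \<and> dist D A = of_rat d \<and>
           dist A C = of_rat e \<and> dist B D = of_rat f"
proof -
  define A B C D :: "real^2" where pts: "A = vector [0, 0]" "B = vector [of_rat x1, of_rat y1]"
    "C = vector [of_rat e, 0]" "D = vector [of_rat x2, of_rat y2]"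
  note q' = q[unfolded quad_conditions_real_iff]
  have "dist P Q = r" if "(P$1 - Q$1)\<^sup>2 + (P$2 - Q$2)\<^sup>2 = r\<^sup>2" "r > 0" for P Q :: "real^2" and r
    using that by (simp flip: dist_vec2_square add: power2_eq_iff_nonneg)
  then have dists: "dist A B = of_rat a" "dist B C = of_rat b" "dist C D = of_rat c" "dist D A = of_rat d"
    "dist A C = of_rat e" "dist B D = of_rat f"
    using q' by (simp_all add: pts power2_commute)
  define e' Y1 Y2 w v :: real where "e' = of_rat e" and "Y1 = of_rat y1" and "Y2 = of_rat y2"
    and "w = of_rat x1 * of_rat y2 - of_rat x2 * of_rat y1" and "v = e' * Y1 - e' * Y2 + w"
  note vars = this
  have ori: "orient A B C = - (e' * Y1)" "orient C D A = e' * Y2" "orient D A B = w" "orient B C D = - v"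
    by (simp_all add: pts vars orient_def algebra_simps)
  have pos: "e' > 0" "- (Y1 * Y2) > 0" "- ((Y1 - Y2) * w) > 0" "(Y1 - Y2) * v > 0"
    using q' unfolding vars by (simp_all only: add_diff_eq)
  then consider "Y1 > 0" "Y2 < 0" | "Y1 < 0" "Y2 > 0"
    by (auto simp: mult_less_0_iff)
  then have cp: "convex_position A B C D"
  proof cases
    case 1
    then have "Y1 - Y2 > 0" by simp
    then have "- w > 0" "v > 0"
      using pos zero_less_mult_pos[of "Y1 - Y2" "- w"] zero_less_mult_pos[of "Y1 - Y2" v] by simp_all
    then show ?thesis
      using 1 pos(1) by (simp add: convex_position_def ori mult_pos_neg)
  next
    case 2
    then have "Y2 - Y1 > 0" by simp
    moreover have "(Y2 - Y1) * w = - ((Y1 - Y2) * w)" "(Y2 - Y1) * - v = (Y1 - Y2) * v"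
      by algebra+
    ultimately have "w > 0" "- v > 0"
      using pos zero_less_mult_pos[of "Y2 - Y1" w] zero_less_mult_pos[of "Y2 - Y1" "- v"]
      by simp_all
    then show ?thesis
      using 2 pos(1) by (simp add: convex_position_def ori mult_pos_neg)
  qed
  have "quad_area A B C D \<in> \<rat>"
    by (simp add: quad_area_convex_position[OF cp] ori vars)
  then have "rational_quadrilateral A B C D"
    using quadrilateral_convex_position[OF cp] by (simp add: rational_quadrilateral_def dists)
  then show ?thesis
    using cp dists convex_quadrilateral_iff_convex_position by blast
qed

theorem theorem1:
  shows "((\<exists>A B C D. convex_quadrilateral A B C D \<and> rational_quadrilateral A B C D) \<longleftrightarrow>
            (\<exists>a b c d e f x1 x2 y1 y2. quad_conditions a b c d e f x1 x2 y1 y2)) \<and>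
         (\<forall>a b c d e f :: rat.
            (\<exists>A B C D. convex_quadrilateral A B C D \<and> rational_quadrilateral A B C D \<and>
               dist A B = of_rat a \<and> dist B C = of_rat b \<and>
               dist C D = of_rat c \<and> dist D A = of_rat d \<and>
               dist A C = of_rat e \<and> dist B D = of_rat f) \<longleftrightarrow>
            (\<exists>x1 x2 y1 y2. quad_conditions a b c d e f x1 x2 y1 y2))"
proof (rule conjI)
  show "(\<exists>A B C D. convex_quadrilateral A B C D \<and> rational_quadrilateral A B C D) \<longleftrightarrow>
    (\<exists>a b c d e f x1 x2 y1 y2. quad_conditions a b c d e f x1 x2 y1 y2)"
  proof
    assume "\<exists>A B C D. convex_quadrilateral A B C D \<and> rational_quadrilateral A B C D"
    then obtain A B C D where quad: "convex_quadrilateral A B C D" "rational_quadrilateral A B C D"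
      by blast
    then obtain a b c d e f where "dist A B = of_rat a" "dist B C = of_rat b" "dist C D = of_rat c"
      "dist D A = of_rat d" "dist A C = of_rat e" "dist B D = of_rat f"
      unfolding rational_quadrilateral_def by (auto elim!: Rats_cases)
    from quad_conditions_of_rational_quadrilateral[OF quad this]
    show "\<exists>a b c d e f x1 x2 y1 y2. quad_conditions a b c d e f x1 x2 y1 y2" by blast
  next
    assume "\<exists>a b c d e f x1 x2 y1 y2. quad_conditions a b c d e f x1 x2 y1 y2"
    then show "\<exists>A B C D. convex_quadrilateral A B C D \<and> rational_quadrilateral A B C D"
      using rational_quadrilateral_of_quad_conditions by blast
  qed
  show "\<forall>a b c d e f :: rat.
            (\<exists>A B C D. convex_quadrilateral A B C D \<and> rational_quadrilateral A B C D \<and>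
               dist A B = of_rat a \<and> dist B C = of_rat b \<and>
               dist C D = of_rat c \<and> dist D A = of_rat d \<and>
               dist A C = of_rat e \<and> dist B D = of_rat f) \<longleftrightarrow>
            (\<exists>x1 x2 y1 y2. quad_conditions a b c d e f x1 x2 y1 y2)"
    by (intro allI iffI; elim exE conjE)
      (rule quad_conditions_of_rational_quadrilateral rational_quadrilateral_of_quad_conditions; assumption)+
qed

end
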